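(* Let $G\subset X$ be a nonempty open convex subset of a real Banach space $X$. Each $g\in\mathcal S_e(G)$ satisfies: for every $u\in X$ there is a dense subset $D_u$ of $G$ such that for every $w\in D_u$ with $[w,w+u]\subset G$, $g^{\natural\natural}(w+tu;u)=g^r(w+tu;u)$ for almost all $t\in[0,1]$. Hence, $\mathcal S_e(G)\subset\mathrm{CLACG}^{\natural ad}(G)$.
   Context: $[x,y]:=\{x+t(y-x):t\in[0,1]\}$. **Convergence in a direction.** A net $(x_\nu)$ converges to $\bar x$ in the direction $v\in X$, written $x_\nu\to_v\bar x$, if there are nets $t_\nu\searrow0$ (i.e. $t_\nu\to 0$, $t_\nu>0$) and $v_\nu\to v$ with $x_\nu=\bar x+t_\nu v_\nu$. Thus $\limsup_{x\to_v\bar x}F(x)=\inf_{\varepsilon>0}\sup\{F(\bar x+tv'):0<t<\varepsilon,\|v'-v\|<\varepsilon\}$. In $\limsup_{x\to\bar x}F(x)$ the point $x=\bar x$ is allowed. **Subderivatives.** For $g:G\to\mathbb R$, $\bar x\in G$, $u\in X$: $g^r(\bar x;u):=\liminf_{t\searrow0}\frac{g(\bar x+tu)-g(\bar x)}{t}$ (and $g^r(\bar x;u):=-\infty$ for $\bar x\notin G$); $g^{\natural}(\bar x;u):=\inf_{\alpha\ge0}\limsup_{x\to_u\bar x}g^r(x;u+\alpha(\bar x-x))$; $g^{\natural\natural}(\bar x;u):=\inf_{\alpha\ge0}\limsup_{x\to\bar x}g^r(x;u+\alpha(\bar x-x))$; and for $g$ locally Lipschitz, $g^\circ(\bar x;u):=\limsup_{t\searrow0,\,x\to\bar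 x}\frac{g(x+tu)-g(x)}{t}$. **Essentially smooth functions.** $\mathcal S_e(G)$ is the class of locally Lipschitz functions $g:G\to\mathbb R$ such that for each $u\in X$ the set $B_u:=\{x\in G:g^\circ(x;u)\ne-g^\circ(x;-u)\}$ is a Haar-null subset of $X$. (A Borel set $N\subset X$ is Haar-null if there is a Radon probability measure $p$ on $X$ with $p(x+N)=0$ for every $x\in X$; an arbitrary set is Haar-null if it is contained in a Haar-null Borel set.) **ACG.** For $\varphi:[a,b]\to\mathbb R$ and $S\subset[a,b]$, $\varphi$ is AC on $S$ if for each $\varepsilon>0$ there is $\delta>0$ such that $\sum_{i=1}^n|\varphi(d_i)-\varphi(c_i)|<\varepsilon$ whenever $\{[c_i,d_i]\}_{i=1}^n$ is a finite collection of non-overlapping intervals with endpoints in $S$ and $\sum(d_i-c_i)<\delta$. $\varphi$ is ACG on $S$ if $\varphi|_S$ is continuous and $S$ is a countable union of sets on each of which $\varphi$ is AC. **Classes.** $\mathrm{CLACG}(G)$ is the class of all real-valued continuous functions on $G$ whose restrictions to line segments $[a,b]\subset G$ are ACG (i.e. $t\mapsto g(a+t(b-a))$ is ACG on $[0,1]$). $\mathrm{CLACG}^{\natural ad}(G)$ is the class of $g\in\mathrm{CLACG}(G)$ such that for every $[\bar x,\bar x+u]\subset G$ there exist sequences $\bar x_n\to\bar x$, $u_n\to u$ such that for every $n$: $g^r(\bar x_n+tu_n;u_n)\in\mathbb R$ and $g^{\natural}(\bar x_n+tu_n;u_n)=g^r(\bar x_n+tu_n;u_n)$ for (Lebesgue)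 almost all $t\in[0,1]$. *)

theory Defs
  imports "HOL-Analysis.Analysis" "HOL-Probability.Probability_Measure"
begin

text \<open>
  Functions \<open>g : G \<rightarrow> \<real>\<close> are represented by total functions. For open \<open>G\<close>, none of the notions
  below depends on the values of \<open>g\<close> outside \<open>G\<close>.
\<close>

section \<open>Convergence in a direction\<close>

text \<open>
  A net \<open>x\<^sub>\<nu>\<close> converges to \<open>x\<close> in the direction \<open>v\<close> if it has the form \<open>x + t\<^sub>\<nu> v\<^sub>\<nu>\<close> with
  \<open>t\<^sub>\<nu> > 0\<close>, \<open>t\<^sub>\<nu> \<rightarrow> 0\<close> and \<open>v\<^sub>\<nu> \<rightarrow> v\<close>.
\<close>

definition at_dir :: "'a::real_normed_vector \<Rightarrow> 'a \<Rightarrow> 'a filter" where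
  "at_dir v x = filtermap (\<lambda>(t, v'). x + t *\<^sub>R v') (at_right (0::real) \<times>\<^sub>F nhds v)"

lemma Limsup_at_dir:
  fixes F :: "'a::real_normed_vector \<Rightarrow> ereal"
  shows "Limsup (at_dir v x) F =
    (INF e\<in>{0::real<..}. SUP (t, v')\<in>{(t, v'). 0 < t \<and> t < e \<and> norm (v' - v) < e}.
      F (x + t *\<^sub>R v'))"
  (is "?L = ?R")
proof (rule antisym)
  show "?L \<le> ?R"
  proof (rule INF_greatest)
    fix e :: real assume "e \<in> {0<..}"
    hence e: "e > 0" by simp
    let ?S = "{(t, v'). 0 < t \<and> t < e \<and> norm (v' - v) < e}"
    have "eventually (\<lambda>p. p \<in> ?S) (at_right (0::real) \<times>\<^sub>F nhds v)"
      unfolding eventually_prod_filter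
      using e
      by (intro exI[of _ "\<lambda>t. 0 < t \<and> t < e"] exI[of _ "\<lambda>v'. norm (v' - v) < e"])
         (auto simp: eventually_at_right_field eventually_nhds_metric dist_norm)
    hence "eventually (\<lambda>p. F (x + fst p *\<^sub>R snd p)
        \<le> (SUP (t, v')\<in>?S. F (x + t *\<^sub>R v'))) (at_right (0::real) \<times>\<^sub>F nhds v)"
    proof (rule eventually_mono)
      fix p :: "real \<times> 'a" assume "p \<in> ?S"
      thus "F (x + fst p *\<^sub>R snd p) \<le> (SUP (t, v')\<in>?S. F (x + t *\<^sub>R v'))"
        by (intro SUP_upper2[of p]) auto
    qed
    hence "eventually (\<lambda>y. F y \<le> (SUP (t, v')\<in>?S. F (x + t *\<^sub>R v'))) (at_dir v x)"
      by (simp add: at_dir_def eventually_filtermap case_prod_unfold)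
    thus "?L \<le> (SUP (t, v')\<in>?S. F (x + t *\<^sub>R v'))" by (rule Limsup_bounded)
  qed
next
  show "?R \<le> ?L"
    unfolding Limsup_def
  proof (rule INF_greatest)
    fix P assume "P \<in> {P. eventually P (at_dir v x)}"
    then obtain Q R where Q: "eventually Q (at_right (0::real))" and R: "eventually R (nhds v)"
      and QR: "\<And>t v'. Q t \<Longrightarrow> R v' \<Longrightarrow> P (x + t *\<^sub>R v')"
      by (auto simp: at_dir_def eventually_filtermap eventually_prod_filter)
    obtain d1 where d1: "d1 > 0" "\<And>t. 0 < t \<Longrightarrow> t < d1 \<Longrightarrow> Q t"
      using Q by (auto simp: eventually_at_right_field)
    obtain d2 where d2: "d2 > 0" "\<And>v'. norm (v' - v) < d2 \<Longrightarrow> R v'"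
      using R by (auto simp: eventually_nhds_metric dist_norm)
    let ?e = "min d1 d2"
    have "?R \<le> (SUP (t, v')\<in>{(t, v'). 0 < t \<and> t < ?e \<and> norm (v' - v) < ?e}. F (x + t *\<^sub>R v'))"
      using d1 d2 by (intro INF_lower) auto
    also have "\<dots> \<le> Sup (F ` Collect P)"
      using d1 d2 QR by (intro SUP_least) (auto intro!: SUP_upper)
    finally show "?R \<le> Sup (F ` Collect P)" .
  qed
qed

section \<open>Subderivatives\<close>

definition radial_subderiv ::
    "'a::real_normed_vector set \<Rightarrow> ('a \<Rightarrow> real) \<Rightarrow> 'a \<Rightarrow> 'a \<Rightarrow> ereal" where
  "radial_subderiv G g x u =
    (if x \<in> G then Liminf (at_right 0) (\<lambda>t::real. ereal ((g (x + t *\<^sub>R u) - g x) / t)) else -\<infinity>)"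

definition natural_subderiv ::
    "'a::real_normed_vector set \<Rightarrow> ('a \<Rightarrow> real) \<Rightarrow> 'a \<Rightarrow> 'a \<Rightarrow> ereal" where
  "natural_subderiv G g x u =
    (INF \<alpha>\<in>{0::real..}. Limsup (at_dir u x) (\<lambda>y. radial_subderiv G g y (u + \<alpha> *\<^sub>R (x - y))))"

text \<open>The limit superior below includes the point \<open>x\<close> itself, hence \<open>nhds\<close> rather than \<open>at\<close>.\<close>

definition natural2_subderiv ::
    "'a::real_normed_vector set \<Rightarrow> ('a \<Rightarrow> real) \<Rightarrow> 'a \<Rightarrow> 'a \<Rightarrow> ereal" where
  "natural2_subderiv G g x u =
    (INF \<alpha>\<in>{0::real..}. Limsup (nhds x) (\<lambda>y. radial_subderiv G g y (u + \<alpha> *\<^sub>R (x - y))))"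

definition clarke_deriv :: "('a::real_normed_vector \<Rightarrow> real) \<Rightarrow> 'a \<Rightarrow> 'a \<Rightarrow> ereal" where
  "clarke_deriv g x u =
    Limsup (at_right (0::real) \<times>\<^sub>F nhds x) (\<lambda>(t, y). ereal ((g (y + t *\<^sub>R u) - g y) / t))"

section \<open>Haar-null sets and essentially smooth functions\<close>

definition radon_prob :: "'a::topological_space measure \<Rightarrow> bool" where
  "radon_prob p \<longleftrightarrow> prob_space p \<and> sets p = sets borel \<and>
    (\<forall>A\<in>sets borel. emeasure p A = (SUP K\<in>{K. compact K \<and> K \<subseteq> A}. emeasure p K))"

definition haar_null_borel :: "'a::real_normed_vector set \<Rightarrow> bool" where
  "haar_null_borel N \<longleftrightarrow> N \<in> sets borel \<and>
    (\<exists>p. radon_prob p \<and> (\<forall>x. emeasure p ((+) x ` N) = 0))"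

definition haar_null :: "'a::real_normed_vector set \<Rightarrow> bool" where
  "haar_null B \<longleftrightarrow> (\<exists>N. haar_null_borel N \<and> B \<subseteq> N)"

definition locally_lipschitz_on :: "'a::metric_space set \<Rightarrow> ('a \<Rightarrow> real) \<Rightarrow> bool" where
  "locally_lipschitz_on G g \<longleftrightarrow> (\<forall>x\<in>G. \<exists>e>0. \<exists>L. L-lipschitz_on (ball x e \<inter> G) g)"

definition ess_smooth :: "'a::real_normed_vector set \<Rightarrow> ('a \<Rightarrow> real) set" where
  "ess_smooth G = {g. locally_lipschitz_on G g \<and>
    (\<forall>u. haar_null {x\<in>G. clarke_deriv g x u \<noteq> - clarke_deriv g x (- u)})}"

section \<open>ACG functions\<close>

definition AC_on :: "real set \<Rightarrow> (real \<Rightarrow> real) \<Rightarrow> bool" where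
  "AC_on S \<phi> \<longleftrightarrow> (\<forall>\<epsilon>>0. \<exists>\<delta>>0. \<forall>(n::nat) c d.
     (\<forall>i<n. c i \<in> S \<and> d i \<in> S \<and> c i \<le> d i) \<and>
     (\<forall>i<n. \<forall>j<n. i \<noteq> j \<longrightarrow> {c i<..<d i} \<inter> {c j<..<d j} = {}) \<and>
     (\<Sum>i<n. d i - c i) < \<delta>
     \<longrightarrow> (\<Sum>i<n. \<bar>\<phi> (d i) - \<phi> (c i)\<bar>) < \<epsilon>)"

definition ACG_on :: "real set \<Rightarrow> (real \<Rightarrow> real) \<Rightarrow> bool" where
  "ACG_on S \<phi> \<longleftrightarrow> continuous_on S \<phi> \<and>
    (\<exists>E :: nat \<Rightarrow> real set. S = (\<Union>n. E n) \<and> (\<forall>n. AC_on (E n) \<phi>))"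

definition CLACG :: "'a::real_normed_vector set \<Rightarrow> ('a \<Rightarrow> real) set" where
  "CLACG G = {g. continuous_on G g \<and>
    (\<forall>a b. closed_segment a b \<subseteq> G \<longrightarrow> ACG_on {0..1} (\<lambda>t. g (a + t *\<^sub>R (b - a))))}"

text \<open>
  The approximating segments are not required to lie in \<open>G\<close>: finiteness of the radial
  subderivative, which is \<open>-\<infinity>\<close> outside \<open>G\<close>, forces this for almost every parameter.
\<close>

definition CLACG_natural_ad :: "'a::real_normed_vector set \<Rightarrow> ('a \<Rightarrow> real) set" where
  "CLACG_natural_ad G = {g \<in> CLACG G.
    \<forall>x u. closed_segment x (x + u) \<subseteq> G \<longrightarrow>
      (\<exists>xs us. xs \<longlonglongrightarrow> x \<and> us \<longlonglongrightarrow> u \<and>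
        (\<forall>n::nat. AE t\<in>{0..1} in lebesgue.
          \<bar>radial_subderiv G g (xs n + t *\<^sub>R us n) (us n)\<bar> \<noteq> \<infinity> \<and>
          natural_subderiv G g (xs n + t *\<^sub>R us n) (us n) =
            radial_subderiv G g (xs n + t *\<^sub>R us n) (us n)))}"

end

theory Submission
  imports Defs
begin

text \<open>
  Call \<open>L\<close> a strict derivative of \<open>g\<close> at \<open>x\<close> in the direction \<open>u\<close> if the difference quotients
  \<open>(g (y + t u) - g y) / t\<close> tend to \<open>L\<close> as \<open>t\<close> decreases to \<open>0\<close> and, jointly, \<open>y\<close> tends to \<open>x\<close>.
  The proof combines two facts.

  Firstly, \<open>- g\<^sup>\<circ>(x; -u)\<close> is the limit inferior of these quotients, whereas \<open>g\<^sup>\<circ>(x; u)\<close> is their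
  limit superior: replacing the base point \<open>y\<close> by \<open>y + t u\<close> turns a quotient in the direction \<open>-u\<close>
  into the negative of one in the direction \<open>u\<close>. So for locally Lipschitz \<open>g\<close> the two Clarke
  derivatives match exactly when \<open>g\<close> has a strict derivative at \<open>x\<close> in the direction \<open>u\<close>
  (\<open>strict_dir_deriv_if_clarke_symmetric\<close>). At such a point the radial subderivatives at all nearby
  points are nearly equal to \<open>L\<close>, and so the radial subderivative and both upper limits built from it
  equal \<open>L\<close> (\<open>radial_subderiv_eq\<close>, \<open>natural2_subderiv_eq\<close>, \<open>natural_subderiv_eq\<close>).

  Secondly, the lines parallel to \<open>u\<close> that meet a Haar-null set only in a set of parameters of measure
  zero pass arbitrarily close to every point (\<open>haar_null_line_avoidance\<close>). A test measure of the
  Haar-null set gives positive mass to some small ball, which can be translated so that its centre is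
  any prescribed point. By Tonelli's theorem, applied to Lebesgue measure and the translated test
  measure, almost every point of that ball lies on a line of the required kind.

  The set \<open>D\<^sub>u\<close> consists of the points of \<open>G\<close> on such lines with respect to the exceptional set of
  \<open>g\<close>. For the inclusion of the classes, segments with direction \<open>u\<close> and initial point in \<open>D\<^sub>u\<close>
  approximate the given one, and a locally Lipschitz function is ACG along every segment.
\<close>

section \<open>Lines that almost avoid a Haar-null set\<close>

text \<open>
  For two nonseparable factors the Borel sets of the product may exceed the product \<open>\<sigma>\<close>-algebra, but
  one second countable factor suffices for equality: an open set is the union, over a countable base of \<open>'a\<close>, of
  the sets \<open>A \<times> V\<close> where \<open>V\<close> is the largest open set with \<open>A \<times> V\<close> inside the given set.
\<close>

lemma open_in_sets_pair_borel:
  fixes S :: "('a::second_countable_topology \<times> 'b::topological_space) set"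
  assumes "open S"
  shows "S \<in> sets (borel \<Otimes>\<^sub>M borel)"
proof -
  obtain B :: "'a set set" where B: "countable B" "topological_basis B"
    using ex_countable_basis by blast
  define V where "V A = \<Union>{V::'b set. open V \<and> A \<times> V \<subseteq> S}" for A
  have "S \<subseteq> (\<Union>A\<in>B. A \<times> V A)"
  proof
    fix z assume "z \<in> S"
    then obtain A W where AW: "open A" "open W" "z \<in> A \<times> W" "A \<times> W \<subseteq> S"
      by (rule open_prod_elim[OF assms])
    then have "fst z \<in> A" by auto
    then obtain A' where A': "A' \<in> B" "fst z \<in> A'" "A' \<subseteq> A"
      by (rule topological_basisE[OF B(2) AW(1)])
    have "A' \<times> W \<subseteq> S" using A'(3) AW(4) by blast
    then have "snd z \<in> V A'" using AW(2,3) unfolding V_def by auto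
    then show "z \<in> (\<Union>A\<in>B. A \<times> V A)" using A' by (cases z) auto
  qed
  moreover have "(\<Union>A\<in>B. A \<times> V A) \<subseteq> S" unfolding V_def by blast
  ultimately have S: "S = (\<Union>A\<in>B. A \<times> V A)" by blast
  have "A \<times> V A \<in> sets (borel \<Otimes>\<^sub>M borel)" if "A \<in> B" for A
    using topological_basis_open[OF B(2) that] unfolding V_def
    by (intro pair_measureI borel_open open_Union) auto
  then show ?thesis
    unfolding S by (intro sets.countable_UN' B(1)) auto
qed

lemma borel_measurable_pair_continuous:
  fixes f :: "'a::second_countable_topology \<times> 'b::topological_space \<Rightarrow> 'c::topological_space"
  assumes "continuous_on UNIV f"
  shows "f \<in> borel_measurable (borel \<Otimes>\<^sub>M borel)"
  using assms
  by (intro borel_measurableI) (auto simp: space_pair_measure intro!: open_in_sets_pair_borel open_vimage)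

text \<open>
  Without separability, countably many small balls need not cover the space. Inner regularity
  provides a compact set of positive mass instead, which finitely many of them cover.
\<close>

lemma radon_prob_ball_pos:
  fixes p :: "'a::metric_space measure"
  assumes "radon_prob p" and "e > 0"
  obtains c where "emeasure p (ball c e) > 0"
proof -
  interpret prob_space p using assms(1) by (simp add: radon_prob_def)
  have sets_p: "sets p = sets borel" using assms(1) by (simp add: radon_prob_def)
  have "space p = UNIV" using sets_eq_imp_space_eq[OF sets_p] by simp
  then have "(SUP K\<in>{K. compact K \<and> K \<subseteq> UNIV}. emeasure p K) = 1"
    using assms(1) emeasure_space_1 by (auto simp: radon_prob_def)
  then have "0 < (SUP K\<in>{K. compact K \<and> K \<subseteq> UNIV}. emeasure p K)"
    by simp
  then obtain K where K: "compact K" "emeasure p K > 0"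
    unfolding less_SUP_iff by auto
  have cover: "K \<subseteq> (\<Union>c\<in>UNIV. ball c e)"
    using \<open>e > 0\<close> by (intro subsetI UN_I[OF UNIV_I]) (rule centre_in_ball[THEN iffD2])
  obtain C where "C \<subseteq> UNIV" and C: "finite C" "K \<subseteq> (\<Union>c\<in>C. ball c e)"
    by (rule compactE_image[OF K(1) open_ball cover])
  have "\<exists>c. emeasure p (ball c e) > 0"
  proof (rule ccontr)
    assume "\<nexists>c. emeasure p (ball c e) > 0"
    then have "emeasure p (ball c e) = 0" for c
      by (simp add: zero_less_iff_neq_zero)
    then have "(\<Union>c\<in>C. ball c e) \<in> null_sets p"
      using C(1) sets_p by (intro null_sets_UN' countable_finite) (auto simp: null_sets_def)
    then have "emeasure p K = 0"
      using emeasure_mono[OF C(2), of p] by (auto simp: null_sets_def)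
    with K(2) show False by simp
  qed
  with that show ?thesis by blast
qed

text \<open>
  Haar-nullity says that for each fixed parameter \<open>t\<close> the points \<open>y\<close> whose translate by \<open>t u\<close> falls
  into the set are null for the test measure. Tonelli's theorem exchanges the two quantifiers, and
  the positive mass of the ball turns \<open>almost every y\<close> into a point of the ball.
\<close>

lemma haar_null_line_avoidance:
  fixes B :: "'a::real_normed_vector set"
  assumes "haar_null B" and "e > 0"
  obtains w where "dist w w0 < e" and "AE t in lebesgue. w + t *\<^sub>R u \<notin> B"
proof -
  obtain N p where BN: "B \<subseteq> N" and N: "N \<in> sets borel" and p: "radon_prob p"
    and null: "\<And>x. emeasure p ((+) x ` N) = 0"
    using assms(1) by (auto simp: haar_null_def haar_null_borel_def)
  interpret P: prob_space p using p by (simp add: radon_prob_def)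
  have sets_p: "sets p = sets borel" using p by (simp add: radon_prob_def)
  interpret pair_sigma_finite lborel p
    by unfold_locales
  obtain c where c: "emeasure p (ball c e) > 0"
    using radon_prob_ball_pos[OF p assms(2)] by blast
  \<comment> \<open>The translation that carries the ball of positive mass to the ball around \<open>w0\<close>.\<close>
  define f where "f t y = (w0 - c) + y + t *\<^sub>R u" for t y
  have sets_eq: "sets (lborel \<Otimes>\<^sub>M p) = sets (borel \<Otimes>\<^sub>M borel)"
    by (intro sets_pair_measure_cong) (simp_all add: sets_p)
  have "(\<lambda>z. f (fst z) (snd z)) \<in> borel_measurable (borel \<Otimes>\<^sub>M borel)"
    unfolding f_def by (intro borel_measurable_pair_continuous continuous_intros)
  then have "(\<lambda>z. f (fst z) (snd z)) \<in> borel_measurable (lborel \<Otimes>\<^sub>M p)"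
    using measurable_cong_sets[OF sets_eq refl] by blast
  then have "(\<lambda>z. f (fst z) (snd z)) -` (- N) \<inter> space (lborel \<Otimes>\<^sub>M p) \<in> sets (lborel \<Otimes>\<^sub>M p)"
    by (rule measurable_sets) (rule borel_comp[OF N])
  moreover have "(\<lambda>z. f (fst z) (snd z)) -` (- N) \<inter> space (lborel \<Otimes>\<^sub>M p)
      = {z \<in> space (lborel \<Otimes>\<^sub>M p). f (fst z) (snd z) \<notin> N}"
    by auto
  ultimately have meas: "{z \<in> space (lborel \<Otimes>\<^sub>M p). f (fst z) (snd z) \<notin> N} \<in> sets (lborel \<Otimes>\<^sub>M p)"
    by simp
  have "AE y in p. f t y \<notin> N" for t
  proof -
    let ?v = "- ((w0 - c) + t *\<^sub>R u)"
    have eq: "(+) ?v ` N = (\<lambda>y. y - ?v) -` N"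
      by (auto simp: image_iff algebra_simps intro!: bexI[where x="_ - ?v"])
    have "(\<lambda>y. y - ?v) -` N \<inter> space borel \<in> sets borel"
      by (intro measurable_sets[OF _ N] borel_measurable_continuous_onI continuous_intros)
    then have "(+) ?v ` N \<in> sets p" unfolding sets_p eq by simp
    with null[of ?v] have "(+) ?v ` N \<in> null_sets p" by (rule null_setsI)
    from AE_not_in[OF this] show ?thesis
    proof eventually_elim
      case (elim y)
      moreover have "y = ?v + f t y" by (simp add: f_def)
      ultimately show ?case by blast
    qed
  qed
  then have "AE t in lborel. AE y in p. f t y \<notin> N" by simp
  then have "AE y in p. AE t in lborel. f t y \<notin> N"
    using AE_commute[OF meas] by simp
  moreover have "\<not> (AE y in p. y \<notin> ball c e)"
  proof
    assume "AE y in p. y \<notin> ball c e"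
    moreover have "ball c e \<in> sets p" by (simp add: sets_p)
    ultimately have "ball c e \<in> null_sets p"
      by (subst AE_iff_null_sets)
    with c show False by (auto simp: null_sets_def)
  qed
  ultimately have "\<exists>y. y \<in> ball c e \<and> (AE t in lborel. f t y \<notin> N)"
    by (metis (mono_tags, lifting) AE_mp AE_I2)
  then obtain y where y: "y \<in> ball c e" "AE t in lborel. f t y \<notin> N" by blast
  show ?thesis
  proof
    show "dist ((w0 - c) + y) w0 < e"
      using y(1) by (simp add: dist_norm norm_minus_commute)
    have "AE t in lborel. (w0 - c) + y + t *\<^sub>R u \<notin> B"
      using y(2) by (rule AE_mp) (use BN in \<open>auto simp: f_def\<close>)
    then show "AE t in lebesgue. (w0 - c) + y + t *\<^sub>R u \<notin> B"
      by (rule AE_completion)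
  qed
qed

section \<open>Strict directional derivatives\<close>

definition strict_dir_deriv :: "('a::real_normed_vector \<Rightarrow> real) \<Rightarrow> 'a \<Rightarrow> 'a \<Rightarrow> real \<Rightarrow> bool" where
  "strict_dir_deriv g x u L \<longleftrightarrow>
    ((\<lambda>(t, y). (g (y + t *\<^sub>R u) - g y) / t) \<longlongrightarrow> L) (at_right 0 \<times>\<^sub>F nhds x)"

lemma filterlim_at_withinD: "filterlim f (at a within S) F \<Longrightarrow> (f \<longlongrightarrow> a) F"
  by (simp add: filterlim_at)

lemma tendsto_moved_base_point:
  fixes x u :: "'a::real_normed_vector"
  shows "((\<lambda>(t, y). y + t *\<^sub>R u) \<longlongrightarrow> x) (at_right (0::real) \<times>\<^sub>F nhds x)"
proof -
  let ?F = "at_right (0::real) \<times>\<^sub>F nhds x"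
  have "(fst \<longlongrightarrow> (0::real)) ?F"
    using filterlim_fst[of "at_right (0::real)" "nhds x"] by (rule filterlim_at_withinD)
  moreover have "(snd \<longlongrightarrow> x) ?F" by (rule filterlim_snd)
  ultimately have "((\<lambda>z. snd z + fst z *\<^sub>R u) \<longlongrightarrow> x + 0 *\<^sub>R u) ?F"
    by (intro tendsto_intros)
  then show ?thesis by (simp add: case_prod_unfold)
qed

text \<open>
  The Lipschitz bound makes both Clarke derivatives finite. Their equality up to sign then squeezes
  the difference quotients between an upper and a lower limit with the same real value.
\<close>

lemma strict_dir_deriv_if_clarke_symmetric:
  fixes G :: "'a::real_normed_vector set"
  assumes "open G" "locally_lipschitz_on G g" "x \<in> G"
    and sym: "clarke_deriv g x u = - clarke_deriv g x (- u)"
  obtains L where "strict_dir_deriv g x u L"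
proof -
  let ?F = "at_right (0::real) \<times>\<^sub>F nhds x"
  let ?q = "\<lambda>(t::real, y). (g (y + t *\<^sub>R u) - g y) / t"
  have F: "?F \<noteq> bot" by (simp add: prod_filter_eq_bot)
  obtain e K where e: "e > 0" and K: "K-lipschitz_on (ball x e \<inter> G) g"
    using assms(2,3) by (auto simp: locally_lipschitz_on_def)
  let ?U = "ball x e \<inter> G"
  have U: "open ?U" "x \<in> ?U" using assms e by auto
  have ev_t: "\<forall>\<^sub>F z in ?F. fst z > 0"
    using filterlim_fst[of "at_right (0::real)" "nhds x"] eventually_at_right_less
    by (auto simp: filterlim_iff)
  have ev_y: "\<forall>\<^sub>F z in ?F. snd z \<in> ?U"
    using filterlim_snd U by (rule topological_tendstoD)
  have ev_yt: "\<forall>\<^sub>F z in ?F. snd z + fst z *\<^sub>R u \<in> ?U"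
    using topological_tendstoD[OF tendsto_moved_base_point U, of u] by (simp add: case_prod_unfold)
  have bound: "\<forall>\<^sub>F z in ?F. \<bar>?q z\<bar> \<le> K * norm u"
    using ev_t ev_y ev_yt
  proof eventually_elim
    case (elim z)
    have "\<bar>g (snd z + fst z *\<^sub>R u) - g (snd z)\<bar> \<le> K * norm (fst z *\<^sub>R u)"
      using lipschitz_on_normD[OF K elim(3,2)] by simp
    then show ?case using elim(1) by (simp add: case_prod_unfold field_simps)
  qed
  have clarke: "clarke_deriv g x u = Limsup ?F (\<lambda>z. ereal (?q z))"
    unfolding clarke_deriv_def by (intro arg_cong2[where f=Limsup] ext) auto
  have "clarke_deriv g x u \<le> ereal (K * norm u)"
    unfolding clarke by (rule Limsup_bounded, use bound in eventually_elim) simp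
  moreover have "ereal (- (K * norm u)) \<le> clarke_deriv g x u"
    unfolding clarke by (rule le_Limsup[OF F], use bound in eventually_elim) simp
  ultimately obtain L where L: "clarke_deriv g x u = ereal L"
    by (cases "clarke_deriv g x u") auto
  then have L': "clarke_deriv g x (- u) = ereal (- L)"
    using sym by (cases "clarke_deriv g x (- u)") auto
  have "strict_dir_deriv g x u L"
    unfolding strict_dir_deriv_def
  proof (rule order_tendstoI)
    fix a assume "L < a"
    then have "Limsup ?F (\<lambda>z. ereal (?q z)) < ereal a" using L clarke by simp
    from Limsup_lessD[OF this] show "\<forall>\<^sub>F z in ?F. ?q z < a" by simp
  next
    fix a assume "a < L"
    then have "clarke_deriv g x (- u) < ereal (- a)" using L' by simp
    from Limsup_lessD[OF this[unfolded clarke_deriv_def]]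
    have "\<forall>\<^sub>F z in ?F. (g (snd z + fst z *\<^sub>R (- u)) - g (snd z)) / fst z < - a"
      by eventually_elim (auto simp: case_prod_unfold)
    \<comment> \<open>The change of base point under which the direction \<open>- u\<close> becomes \<open>u\<close>.\<close>
    moreover have "filterlim (\<lambda>(t, y). (t, y + t *\<^sub>R u)) ?F ?F"
      using filterlim_Pair[OF filterlim_fst tendsto_moved_base_point[of u x]]
      by (simp add: case_prod_unfold)
    ultimately show "\<forall>\<^sub>F z in ?F. a < ?q z"
      by (rule eventually_compose_filterlim[THEN eventually_mono])
         (auto simp: case_prod_unfold diff_divide_distrib)
  qed
  with that show ?thesis by blast
qed

lemma strict_dir_deriv_nearby:
  assumes "strict_dir_deriv g x u L" and "e > 0"
  shows "\<forall>\<^sub>F y in nhds x. \<forall>\<^sub>F t in at_right 0. \<bar>(g (y + t *\<^sub>R u) - g y) / t - L\<bar> < e"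
proof -
  have "\<forall>\<^sub>F (t, y) in at_right 0 \<times>\<^sub>F nhds x. \<bar>(g (y + t *\<^sub>R u) - g y) / t - L\<bar> < e"
    using tendstoD[OF assms(1)[unfolded strict_dir_deriv_def] assms(2)]
    by (simp add: dist_real_def case_prod_unfold)
  then obtain P Q where "eventually P (at_right 0)" "eventually Q (nhds x)"
      and PQ: "\<And>t y. P t \<Longrightarrow> Q y \<Longrightarrow> \<bar>(g (y + t *\<^sub>R u) - g y) / t - L\<bar> < e"
    unfolding eventually_prod_filter by auto
  then show ?thesis
    by (auto elim!: eventually_mono)
qed

lemma radial_subderiv_eq:
  assumes "strict_dir_deriv g x u L" and "x \<in> G"
  shows "radial_subderiv G g x u = ereal L"
proof -
  have "filterlim (\<lambda>t. (t, x)) (at_right 0 \<times>\<^sub>F nhds x) (at_right (0::real))"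
    by (intro filterlim_Pair filterlim_ident tendsto_const)
  from filterlim_compose[OF assms(1)[unfolded strict_dir_deriv_def] this]
  have "((\<lambda>t. (g (x + t *\<^sub>R u) - g x) / t) \<longlongrightarrow> L) (at_right 0)" by simp
  then have "((\<lambda>t. ereal ((g (x + t *\<^sub>R u) - g x) / t)) \<longlongrightarrow> ereal L) (at_right 0)" by simp
  from lim_imp_Liminf[OF _ this] show ?thesis
    using assms(2) by (simp add: radial_subderiv_def)
qed

text \<open>
  The value \<open>-\<infinity>\<close> outside \<open>G\<close> is harmless for an upper bound, which therefore holds on a full
  neighbourhood of \<open>x\<close>.
\<close>

lemma Limsup_radial_subderiv_le:
  assumes "strict_dir_deriv g x u L"
  shows "Limsup (nhds x) (\<lambda>y. radial_subderiv G g y u) \<le> ereal L"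
proof (rule ereal_le_epsilon2)
  fix e :: real assume "e > 0"
  have "\<forall>\<^sub>F y in nhds x. radial_subderiv G g y u \<le> ereal (L + e)"
    using strict_dir_deriv_nearby[OF assms \<open>e > 0\<close>]
  proof eventually_elim
    case (elim y)
    let ?q = "\<lambda>t. ereal ((g (y + t *\<^sub>R u) - g y) / t)"
    have "Liminf (at_right 0) ?q \<le> Limsup (at_right 0) ?q"
      by (rule Liminf_le_Limsup) simp
    also have "\<dots> \<le> ereal (L + e)"
      using elim by (intro Limsup_bounded) (auto elim!: eventually_mono)
    finally show ?case by (simp add: radial_subderiv_def)
  qed
  then show "Limsup (nhds x) (\<lambda>y. radial_subderiv G g y u) \<le> ereal L + ereal e"
    by (intro Limsup_bounded) simp
qed

text \<open>
  The upper bound comes from \<open>\<alpha> = 0\<close>; the lower bound holds for every \<open>\<alpha>\<close> because the limit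
  superior admits the point \<open>y = x\<close>, where the correction term vanishes.
\<close>

lemma natural2_subderiv_eq:
  assumes "strict_dir_deriv g x u L" and "x \<in> G"
  shows "natural2_subderiv G g x u = ereal L"
proof (rule antisym)
  have "natural2_subderiv G g x u \<le> Limsup (nhds x) (\<lambda>y. radial_subderiv G g y (u + 0 *\<^sub>R (x - y)))"
    unfolding natural2_subderiv_def by (rule INF_lower) simp
  then show "natural2_subderiv G g x u \<le> ereal L"
    using Limsup_radial_subderiv_le[OF assms(1), of G] by simp
  show "ereal L \<le> natural2_subderiv G g x u"
    unfolding natural2_subderiv_def
  proof (rule INF_greatest)
    fix \<alpha> :: real
    let ?h = "\<lambda>y. radial_subderiv G g y (u + \<alpha> *\<^sub>R (x - y))"
    have "?h x \<le> Limsup (nhds x) ?h"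
      unfolding Limsup_def by (intro INF_greatest SUP_upper) (auto dest: eventually_nhds_x_imp_x)
    then show "ereal L \<le> Limsup (nhds x) ?h"
      using radial_subderiv_eq[OF assms] by simp
  qed
qed

lemma at_dir_le_nhds: "at_dir v x \<le> nhds x"
proof -
  have "((\<lambda>z. x + fst z *\<^sub>R snd z) \<longlongrightarrow> x + 0 *\<^sub>R v) (at_right (0::real) \<times>\<^sub>F nhds v)"
    by (intro tendsto_intros filterlim_snd filterlim_at_withinD[OF filterlim_fst])
  then show ?thesis
    by (simp add: at_dir_def filterlim_def case_prod_unfold)
qed

lemma ray_le_at_dir: "filtermap (\<lambda>s. x + s *\<^sub>R v) (at_right 0) \<le> at_dir v x"
proof -
  have "filterlim (\<lambda>s. (s, v)) (at_right 0 \<times>\<^sub>F nhds v) (at_right (0::real))"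
    by (intro filterlim_Pair filterlim_ident tendsto_const)
  then have "filtermap (\<lambda>(s, w). x + s *\<^sub>R w) (filtermap (\<lambda>s. (s, v)) (at_right 0)) \<le> at_dir v x"
    unfolding at_dir_def filterlim_def by (rule filtermap_mono)
  then show ?thesis by (simp add: filtermap_filtermap)
qed

lemma Limsup_filter_mono:
  assumes "F \<le> F'"
  shows "Limsup F f \<le> Limsup F' f"
  using assms unfolding Limsup_def by (intro INF_superset_mono) (auto simp: le_filter_def)

text \<open>
  Here the point \<open>x\<close> itself is excluded, so the lower bound is obtained along the ray
  \<open>y = x + s u\<close>. There \<open>u + \<alpha> (x - y) = (1 - \<alpha> s) u\<close> is a positive multiple of \<open>u\<close> for small \<open>s\<close>,
  and the factor tends to \<open>1\<close>.
\<close>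

lemma natural_subderiv_eq:
  assumes "strict_dir_deriv g x u L" and "x \<in> G" and "open G"
  shows "natural_subderiv G g x u = ereal L"
proof (rule antisym)
  have "natural_subderiv G g x u \<le> Limsup (at_dir u x) (\<lambda>y. radial_subderiv G g y (u + 0 *\<^sub>R (x - y)))"
    unfolding natural_subderiv_def by (rule INF_lower) simp
  also have "\<dots> \<le> Limsup (nhds x) (\<lambda>y. radial_subderiv G g y u)"
    using Limsup_filter_mono[OF at_dir_le_nhds] by simp
  also have "\<dots> \<le> ereal L" by (rule Limsup_radial_subderiv_le[OF assms(1)])
  finally show "natural_subderiv G g x u \<le> ereal L" .
  show "ereal L \<le> natural_subderiv G g x u"
    unfolding natural_subderiv_def
  proof (rule INF_greatest)
    fix \<alpha> :: real
    let ?h = "\<lambda>y. radial_subderiv G g y (u + \<alpha> *\<^sub>R (x - y))"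
    show "ereal L \<le> Limsup (at_dir u x) ?h"
    proof (rule ereal_le_epsilon2)
      fix e :: real assume "e > 0"
      have nhds_ray: "((\<lambda>s. x + s *\<^sub>R u) \<longlongrightarrow> x) (at_right 0)"
        using order_trans[OF ray_le_at_dir at_dir_le_nhds] by (simp add: filterlim_def)
      have factor: "((\<lambda>s. 1 - \<alpha> * s) \<longlongrightarrow> 1 - \<alpha> * 0) (at_right 0)"
        by (intro tendsto_intros)
      have "\<forall>\<^sub>F y in nhds x. y \<in> G \<and> (\<forall>\<^sub>F t in at_right 0. L - e < (g (y + t *\<^sub>R u) - g y) / t)"
        using eventually_nhds_in_open[OF assms(3,2)] strict_dir_deriv_nearby[OF assms(1) \<open>e > 0\<close>]
        by eventually_elim (auto elim!: eventually_mono)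
      with nhds_ray have "\<forall>\<^sub>F s in at_right 0. x + s *\<^sub>R u \<in> G \<and>
          (\<forall>\<^sub>F t in at_right 0. L - e < (g (x + s *\<^sub>R u + t *\<^sub>R u) - g (x + s *\<^sub>R u)) / t)"
        by (auto simp: filterlim_iff)
      moreover have "\<forall>\<^sub>F s in at_right 0. 1 - \<alpha> * s > 0"
        using order_tendstoD(1)[OF factor, of 0] by simp
      ultimately have "\<forall>\<^sub>F s in at_right 0. ereal ((1 - \<alpha> * s) * (L - e)) \<le> ?h (x + s *\<^sub>R u)"
      proof eventually_elim
        case (elim s)
        let ?c = "1 - \<alpha> * s" and ?y = "x + s *\<^sub>R u"
        have dir: "u + \<alpha> *\<^sub>R (x - ?y) = ?c *\<^sub>R u"
          by (simp add: scaleR_diff_left)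
        have "filterlim (\<lambda>t. t * ?c) (at_right 0) (at_right 0)"
          using filterlim_times_pos[OF filterlim_ident, of ?c 0 0] elim(2) by (simp add: mult.commute)
        with elim(1) have "\<forall>\<^sub>F t in at_right 0. L - e < (g (?y + (t * ?c) *\<^sub>R u) - g ?y) / (t * ?c)"
          by (auto simp: filterlim_iff)
        then have "\<forall>\<^sub>F t in at_right 0. ereal (?c * (L - e)) \<le> ereal ((g (?y + t *\<^sub>R (?c *\<^sub>R u)) - g ?y) / t)"
          using eventually_at_right_less[of "0::real"]
        proof eventually_elim
          case (elim t)
          then have "?c * (L - e) \<le> ?c * ((g (?y + (t * ?c) *\<^sub>R u) - g ?y) / (t * ?c))"
            using \<open>0 < ?c\<close> by (intro mult_left_mono) auto
          then show ?case using \<open>0 < ?c\<close> by simp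
        qed
        then have "ereal (?c * (L - e)) \<le> radial_subderiv G g ?y (?c *\<^sub>R u)"
          using elim(1) by (simp add: radial_subderiv_def Liminf_bounded)
        then show ?case by (simp only: dir)
      qed
      then have "Limsup (at_right 0) (\<lambda>s. ereal ((1 - \<alpha> * s) * (L - e)))
          \<le> Limsup (at_right 0) (\<lambda>s. ?h (x + s *\<^sub>R u))"
        by (rule Limsup_mono)
      also have "\<dots> \<le> Limsup (filtermap (\<lambda>s. x + s *\<^sub>R u) (at_right 0)) ?h"
        by (rule Limsup_filtermap_ge)
      also have "\<dots> \<le> Limsup (at_dir u x) ?h"
        by (rule Limsup_filter_mono[OF ray_le_at_dir])
      finally have "Limsup (at_right 0) (\<lambda>s. ereal ((1 - \<alpha> * s) * (L - e))) \<le> Limsup (at_dir u x) ?h" .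
      moreover have "((\<lambda>s. ereal ((1 - \<alpha> * s) * (L - e))) \<longlongrightarrow> ereal (L - e)) (at_right 0)"
        using tendsto_mult[OF factor tendsto_const[of "L - e"]] by simp
      ultimately have "ereal (L - e) \<le> Limsup (at_dir u x) ?h"
        using lim_imp_Limsup[OF trivial_limit_at_right_real] by metis
      then have "ereal (L - e) + ereal e \<le> Limsup (at_dir u x) ?h + ereal e"
        by (rule add_right_mono)
      then show "ereal L \<le> Limsup (at_dir u x) ?h + ereal e" by simp
    qed
  qed
qed

section \<open>Locally Lipschitz functions along segments\<close>

lemma lipschitz_on_imp_AC_on:
  fixes \<phi> :: "real \<Rightarrow> real"
  assumes "K-lipschitz_on S \<phi>"
  shows "AC_on S \<phi>"
  unfolding AC_on_def
proof (intro allI impI)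
  fix \<epsilon> :: real assume "\<epsilon> > 0"
  have K: "K \<ge> 0" by (rule lipschitz_on_nonneg[OF assms])
  have "(\<Sum>i<n. \<bar>\<phi> (d i) - \<phi> (c i)\<bar>) < \<epsilon>"
    if cd: "\<forall>i<n. c i \<in> S \<and> d i \<in> S \<and> c i \<le> d i" and small: "(\<Sum>i<n. d i - c i) < \<epsilon> / (K + 1)"
    for n :: nat and c d
  proof -
    have "(\<Sum>i<n. \<bar>\<phi> (d i) - \<phi> (c i)\<bar>) \<le> (\<Sum>i<n. K * (d i - c i))"
      using cd lipschitz_onD[OF assms] by (intro sum_mono) (fastforce simp: dist_real_def)
    also have "\<dots> \<le> (K + 1) * (\<Sum>i<n. d i - c i)"
      using cd by (auto simp: sum_distrib_left intro!: sum_mono mult_right_mono)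
    also have "\<dots> < \<epsilon>" using small K by (simp add: field_simps)
    finally show ?thesis .
  qed
  then show "\<exists>\<delta>>0. \<forall>(n::nat) c d.
     (\<forall>i<n. c i \<in> S \<and> d i \<in> S \<and> c i \<le> d i) \<and>
     (\<forall>i<n. \<forall>j<n. i \<noteq> j \<longrightarrow> {c i<..<d i} \<inter> {c j<..<d j} = {}) \<and>
     (\<Sum>i<n. d i - c i) < \<delta>
     \<longrightarrow> (\<Sum>i<n. \<bar>\<phi> (d i) - \<phi> (c i)\<bar>) < \<epsilon>"
    using \<open>\<epsilon> > 0\<close> K by (intro exI[of _ "\<epsilon> / (K + 1)"]) auto
qed

lemma locally_lipschitz_on_imp_continuous_on:
  assumes "locally_lipschitz_on G g"
  shows "continuous_on G g"
  unfolding continuous_on_eq_continuous_within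
proof
  fix x assume "x \<in> G"
  then obtain e K where e: "e > 0" and K: "K-lipschitz_on (ball x e \<inter> G) g"
    using assms by (auto simp: locally_lipschitz_on_def)
  have "continuous (at x within G \<inter> ball x e) g"
    using lipschitz_on_continuous_within[OF K, of x] \<open>x \<in> G\<close> e by (simp add: Int_commute)
  moreover have "at x within G \<inter> ball x e = at x within G"
    using e by (intro at_within_nhd[of _ "ball x e"]) auto
  ultimately show "continuous (at x within G) g" by simp
qed

text \<open>By the Lindelof property, countably many of the sets on which \<open>\<phi>\<close> is Lipschitz cover \<open>S\<close>.\<close>

lemma locally_lipschitz_on_imp_ACG_on:
  fixes \<phi> :: "real \<Rightarrow> real"
  assumes "locally_lipschitz_on S \<phi>"
  shows "ACG_on S \<phi>"
proof -
  define \<F> where "\<F> = {U. open U \<and> (\<exists>K. K-lipschitz_on (U \<inter> S) \<phi>)}"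
  obtain \<F>' where \<F>': "\<F>' \<subseteq> \<F>" "countable \<F>'" "\<Union>\<F>' = \<Union>\<F>"
    using Lindelof[of \<F>] by (auto simp: \<F>_def)
  define E where "E n = from_nat_into (insert {} \<F>') n \<inter> S" for n
  have range: "range (from_nat_into (insert {} \<F>')) = insert {} \<F>'"
    using \<F>'(2) by (intro range_from_nat_into) auto
  have "x \<in> \<Union>\<F>" if x: "x \<in> S" for x
  proof -
    obtain e K where "e > 0" "K-lipschitz_on (ball x e \<inter> S) \<phi>"
      using assms x by (auto simp: locally_lipschitz_on_def)
    then have "ball x e \<in> \<F>" "x \<in> ball x e" by (auto simp: \<F>_def)
    then show ?thesis by blast
  qed
  then have "S = \<Union>(insert {} \<F>') \<inter> S" using \<F>'(3) by auto
  also have "\<dots> = (\<Union>n. E n)" unfolding E_def by (subst range[symmetric]) auto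
  finally have "S = (\<Union>n. E n)" .
  moreover have "AC_on (E n) \<phi>" for n
  proof -
    have "from_nat_into (insert {} \<F>') n \<in> insert {} \<F>'"
      using range by blast
    moreover have "0-lipschitz_on {} \<phi>" by simp
    ultimately obtain K where "K-lipschitz_on (E n) \<phi>"
      using \<F>'(1) unfolding E_def \<F>_def by fastforce
    then show ?thesis by (rule lipschitz_on_imp_AC_on)
  qed
  ultimately show ?thesis
    using locally_lipschitz_on_imp_continuous_on[OF assms] unfolding ACG_on_def by blast
qed

lemma locally_lipschitz_on_affine:
  fixes a v :: "'a::real_normed_vector"
  assumes g: "locally_lipschitz_on G g" and S: "\<And>t. t \<in> S \<Longrightarrow> a + t *\<^sub>R v \<in> G"
  shows "locally_lipschitz_on S (\<lambda>t. g (a + t *\<^sub>R v))"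
  unfolding locally_lipschitz_on_def
proof
  fix s assume "s \<in> S"
  then obtain e K where e: "e > 0" and K: "K-lipschitz_on (ball (a + s *\<^sub>R v) e \<inter> G) g"
    using g S[OF \<open>s \<in> S\<close>] unfolding locally_lipschitz_on_def by blast
  have dist: "dist (a + s *\<^sub>R v) (a + t *\<^sub>R v) = \<bar>s - t\<bar> * norm v" for s t
    by (simp add: dist_norm flip: scaleR_diff_left)
  define r where "r = e / (norm v + 1)"
  have v: "norm v + 1 > 0" using norm_ge_zero[of v] by linarith
  have r: "r > 0" using e v by (simp add: r_def)
  have "(\<lambda>t. a + t *\<^sub>R v) ` (ball s r \<inter> S) \<subseteq> ball (a + s *\<^sub>R v) e \<inter> G"
  proof (rule image_subsetI)
    fix t assume "t \<in> ball s r \<inter> S"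
    then have t: "dist s t < r" "t \<in> S" by auto
    have "\<bar>s - t\<bar> * norm v \<le> \<bar>s - t\<bar> * (norm v + 1)" by (intro mult_left_mono) auto
    also have "\<dots> < e" using t(1) v by (simp add: r_def dist_real_def field_simps)
    finally show "a + t *\<^sub>R v \<in> ball (a + s *\<^sub>R v) e \<inter> G"
      using S[OF t(2)] by (simp only: mem_ball dist Int_iff simp_thms)
  qed
  from lipschitz_on_subset[OF K this]
  have "(K * norm v)-lipschitz_on (ball s r \<inter> S) (\<lambda>t. g (a + t *\<^sub>R v))"
    by (intro lipschitz_on_compose2) (auto intro!: lipschitz_onI simp: dist dist_real_def mult.commute)
  with r show "\<exists>r>0. \<exists>K. K-lipschitz_on (ball s r \<inter> S) (\<lambda>t. g (a + t *\<^sub>R v))" by blast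
qed

lemma segment_param_in:
  assumes "closed_segment w (w + u) \<subseteq> G" and "t \<in> {0..1}"
  shows "w + t *\<^sub>R u \<in> G"
  using assms by (auto simp: closed_segment_image_interval algebra_simps image_subset_iff)

lemma locally_lipschitz_on_imp_CLACG:
  assumes "locally_lipschitz_on G g"
  shows "g \<in> CLACG G"
proof -
  have "ACG_on {0..1} (\<lambda>t. g (a + t *\<^sub>R (b - a)))" if "closed_segment a b \<subseteq> G" for a b
    using that
    by (intro locally_lipschitz_on_imp_ACG_on locally_lipschitz_on_affine[OF assms] segment_param_in) auto
  then show ?thesis
    using locally_lipschitz_on_imp_continuous_on[OF assms] by (simp add: CLACG_def)
qed

section \<open>Essentially smooth functions\<close>

text \<open>
  This is the common source of both assertions of the theorem: at a point with a strict derivative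
  all the subderivatives in question take the same finite value.
\<close>

lemma ess_smooth_dense_strict_dir_deriv:
  fixes G :: "'a::real_normed_vector set"
  assumes "open G" and g: "g \<in> ess_smooth G"
  obtains D where "D \<subseteq> G" and "G \<subseteq> closure D"
    and "\<forall>w\<in>D. closed_segment w (w + u) \<subseteq> G \<longrightarrow>
      (AE t\<in>{0..1} in lebesgue. w + t *\<^sub>R u \<in> G \<and> (\<exists>L. strict_dir_deriv g (w + t *\<^sub>R u) u L))"
proof
  let ?B = "{x\<in>G. clarke_deriv g x u \<noteq> - clarke_deriv g x (- u)}"
  let ?D = "{w\<in>G. AE t in lebesgue. w + t *\<^sub>R u \<notin> ?B}"
  have lip: "locally_lipschitz_on G g" and null: "haar_null ?B"
    using g by (auto simp: ess_smooth_def)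
  show "?D \<subseteq> G" by blast
  show "G \<subseteq> closure ?D"
  proof
    fix x assume "x \<in> G"
    show "x \<in> closure ?D"
      unfolding closure_approachable
    proof (intro allI impI)
      fix e :: real assume "e > 0"
      obtain d where d: "d > 0" "ball x d \<subseteq> G"
        using \<open>open G\<close> \<open>x \<in> G\<close> by (meson openE)
      obtain w where w: "dist w x < min d e" "AE t in lebesgue. w + t *\<^sub>R u \<notin> ?B"
        using haar_null_line_avoidance[OF null, of "min d e" x u] \<open>e > 0\<close> d(1) by auto
      moreover have "w \<in> G" using w(1) d(2) by (auto simp: dist_commute)
      ultimately show "\<exists>w\<in>?D. dist w x < e" by auto
    qed
  qed
  show "\<forall>w\<in>?D. closed_segment w (w + u) \<subseteq> G \<longrightarrow>
      (AE t\<in>{0..1} in lebesgue. w + t *\<^sub>R u \<in> G \<and> (\<exists>L. strict_dir_deriv g (w + t *\<^sub>R u) u L))"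
  proof (intro ballI impI)
    fix w assume "w \<in> ?D" and seg: "closed_segment w (w + u) \<subseteq> G"
    then have "AE t in lebesgue. w + t *\<^sub>R u \<notin> ?B" by blast
    then show "AE t\<in>{0..1} in lebesgue. w + t *\<^sub>R u \<in> G \<and> (\<exists>L. strict_dir_deriv g (w + t *\<^sub>R u) u L)"
    proof eventually_elim
      case (elim t)
      show ?case
      proof
        assume "t \<in> {0..1}"
        with seg have "w + t *\<^sub>R u \<in> G" by (rule segment_param_in)
        moreover from this elim
        obtain L where "strict_dir_deriv g (w + t *\<^sub>R u) u L"
          using strict_dir_deriv_if_clarke_symmetric[OF \<open>open G\<close> lip] by blast
        ultimately show "w + t *\<^sub>R u \<in> G \<and> (\<exists>L. strict_dir_deriv g (w + t *\<^sub>R u) u L)" by blast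
      qed
    qed
  qed
qed

lemma ess_smooth_subset_CLACG_natural_ad:
  fixes G :: "'a::real_normed_vector set"
  assumes "open G" and "convex G"
  shows "ess_smooth G \<subseteq> CLACG_natural_ad G"
proof
  fix g assume g: "g \<in> ess_smooth G"
  then have clacg: "g \<in> CLACG G"
    by (intro locally_lipschitz_on_imp_CLACG) (simp add: ess_smooth_def)
  have "\<exists>xs us. xs \<longlonglongrightarrow> x \<and> us \<longlonglongrightarrow> u \<and>
        (\<forall>n::nat. AE t\<in>{0..1} in lebesgue.
          \<bar>radial_subderiv G g (xs n + t *\<^sub>R us n) (us n)\<bar> \<noteq> \<infinity> \<and>
          natural_subderiv G g (xs n + t *\<^sub>R us n) (us n) =
            radial_subderiv G g (xs n + t *\<^sub>R us n) (us n))"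
    if seg: "closed_segment x (x + u) \<subseteq> G" for x u
  proof -
    obtain D where D: "D \<subseteq> G" "G \<subseteq> closure D"
      and strict: "\<forall>w\<in>D. closed_segment w (w + u) \<subseteq> G \<longrightarrow>
        (AE t\<in>{0..1} in lebesgue. w + t *\<^sub>R u \<in> G \<and> (\<exists>L. strict_dir_deriv g (w + t *\<^sub>R u) u L))"
      using ess_smooth_dense_strict_dir_deriv[OF assms(1) g, of u] by blast
    have ends: "x \<in> G" "x + u \<in> G" using seg by auto
    then obtain ys where ys: "\<And>n. ys n \<in> D" "ys \<longlonglongrightarrow> x"
      using D(2) closure_sequential[of x D] by auto
    have "(\<lambda>n. ys n + u) \<longlonglongrightarrow> x + u" using ys(2) by (intro tendsto_intros)
    then have "\<forall>\<^sub>F n in sequentially. ys n + u \<in> G"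
      using assms(1) ends(2) by (rule topological_tendstoD)
    then obtain n0 where n0: "\<And>n. n \<ge> n0 \<Longrightarrow> ys n + u \<in> G"
      by (auto simp: eventually_sequentially)
    define xs where "xs n = ys (n + n0)" for n
    have "xs \<longlonglongrightarrow> x" unfolding xs_def using ys(2) by (rule LIMSEQ_ignore_initial_segment)
    moreover have "AE t\<in>{0..1} in lebesgue. \<bar>radial_subderiv G g (xs n + t *\<^sub>R u) u\<bar> \<noteq> \<infinity> \<and>
          natural_subderiv G g (xs n + t *\<^sub>R u) u = radial_subderiv G g (xs n + t *\<^sub>R u) u" for n
    proof -
      have "xs n \<in> D" "xs n \<in> G" "xs n + u \<in> G"
        using ys(1) D(1) n0[of "n + n0"] by (auto simp: xs_def)
      then have "AE t\<in>{0..1} in lebesgue. xs n + t *\<^sub>R u \<in> G \<and> (\<exists>L. strict_dir_deriv g (xs n + t *\<^sub>R u) u L)"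
        using assms(2) by (intro strict[rule_format] closed_segment_subset)
      then show ?thesis
        by eventually_elim (auto simp: radial_subderiv_eq natural_subderiv_eq assms(1))
    qed
    ultimately show ?thesis
      by (intro exI[of _ xs] exI[of _ "\<lambda>_. u"]) auto
  qed
  with clacg show "g \<in> CLACG_natural_ad G"
    unfolding CLACG_natural_ad_def by blast
qed

theorem proposition5p3:
  fixes G :: "'a::banach set"
  assumes "G \<noteq> {}" and "open G" and "convex G"
  shows "(\<forall>g\<in>ess_smooth G. \<forall>u. \<exists>D. D \<subseteq> G \<and> G \<subseteq> closure D \<and>
           (\<forall>w\<in>D. closed_segment w (w + u) \<subseteq> G \<longrightarrow>
             (AE t\<in>{0..1} in lebesgue.
               natural2_subderiv G g (w + t *\<^sub>R u) u = radial_subderiv G g (w + t *\<^sub>R u) u)))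
         \<and> ess_smooth G \<subseteq> CLACG_natural_ad G"
proof (intro conjI ballI allI)
  fix g u assume g: "g \<in> ess_smooth G"
  obtain D where D: "D \<subseteq> G" "G \<subseteq> closure D"
    and strict: "\<forall>w\<in>D. closed_segment w (w + u) \<subseteq> G \<longrightarrow>
      (AE t\<in>{0..1} in lebesgue. w + t *\<^sub>R u \<in> G \<and> (\<exists>L. strict_dir_deriv g (w + t *\<^sub>R u) u L))"
    using ess_smooth_dense_strict_dir_deriv[OF assms(2) g, of u] by blast
  have "AE t\<in>{0..1} in lebesgue. natural2_subderiv G g (w + t *\<^sub>R u) u = radial_subderiv G g (w + t *\<^sub>R u) u"
    if "w \<in> D" "closed_segment w (w + u) \<subseteq> G" for w
    using strict[rule_format, OF that]
    by eventually_elim (auto simp: radial_subderiv_eq natural2_subderiv_eq)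
  with D show "\<exists>D. D \<subseteq> G \<and> G \<subseteq> closure D \<and>
      (\<forall>w\<in>D. closed_segment w (w + u) \<subseteq> G \<longrightarrow>
        (AE t\<in>{0..1} in lebesgue.
          natural2_subderiv G g (w + t *\<^sub>R u) u = radial_subderiv G g (w + t *\<^sub>R u) u))"
    by blast
qed (rule ess_smooth_subset_CLACG_natural_ad[OF assms(2,3)])

end
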